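(* Given a signature $(S,F,P)$, consider the following procedure: initialize $S_{0I} := \emptyset$ and $S_{0F} := S$; then repeat, until an iteration produces no change, the updates $S_{0I} := S_{0I} \cup \{ s \in S \mid \forall (g: s_1 \times \cdots \times s_n \to s) \in F_s\ \forall i \in \{1,\dots,n\}: s_i \in S_{0I} \}$ and $S_{0F} := S_{0F} \setminus \{ s \in S \mid \exists (g: s_1 \times \cdots \times s_n \to s) \in F_s\ \forall i \in \{1,\dots,n\}: s_i \notin S_{0F} \}$. Then the resulting sets are exactly $S_{0F}$, the set of sorts having no finite tree, and $S_{0I}$, the set of sorts having no infinite tree.
   Context: A signature $(S,F,P)$: $S$ is a set of sorts; $F$ a set of function symbols (generators), each with an arity $g: s_1\times\cdots\times s_n\to s$ ($n\ge0$), in which case $g$ is a generator of $s$; $F_s$ denotes the set of generators of $s$, assumed nonempty, and every sort is assumed to have at least two generators; $P=\{\mathrm{fin}_s : s\in S\}$. A tree of sort $s$ is a (possibly infinite) rooted ordered tree whose nodes are labeled by generators, the root being labeled by some $g: s_1\times\cdots\times s_n\to s$ in $F_s$ and its $n$ children, in order, being roots of trees of sorts $s_1,\dots,s_n$. A tree is finite if it has finitely many nodes. *)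

theory Defs
  imports Main "HOL-Library.While_Combinator"
begin

datatype 's pred = Fin 's

text \<open>A generator \<open>g : s\<^sub>1 \<times> \<dots> \<times> s\<^sub>n \<rightarrow> s\<close> has \<open>arg_sorts g = [s\<^sub>1, \<dots>, s\<^sub>n]\<close> and \<open>res_sort g = s\<close>;
  the two maps are relevant only on \<open>gens\<close>. No finiteness of \<open>sorts\<close> or \<open>gens\<close> is assumed.\<close>

record ('s, 'f) signature =
  sorts :: "'s set"
  gens :: "'f set"
  preds :: "'s pred set"
  arg_sorts :: "'f \<Rightarrow> 's list"
  res_sort :: "'f \<Rightarrow> 's"

definition gens_of :: "('s, 'f) signature \<Rightarrow> 's \<Rightarrow> 'f set" where
  "gens_of \<Sigma> s = {g \<in> gens \<Sigma>. res_sort \<Sigma> g = s}"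

definition wf_signature :: "('s, 'f) signature \<Rightarrow> bool" where
  "wf_signature \<Sigma> \<longleftrightarrow>
     (\<forall>g \<in> gens \<Sigma>. res_sort \<Sigma> g \<in> sorts \<Sigma> \<and> set (arg_sorts \<Sigma> g) \<subseteq> sorts \<Sigma>) \<and>
     (\<forall>s \<in> sorts \<Sigma>. gens_of \<Sigma> s \<noteq> {}) \<and>
     (\<forall>s \<in> sorts \<Sigma>. \<exists>g \<in> gens_of \<Sigma> s. \<exists>h \<in> gens_of \<Sigma> s. g \<noteq> h) \<and>
     preds \<Sigma> = Fin ` sorts \<Sigma>"

codatatype 'f tree = Node (root: 'f) (children: "'f tree list")

coinductive tree_of_sort :: "('s, 'f) signature \<Rightarrow> 's \<Rightarrow> 'f tree \<Rightarrow> bool" for \<Sigma> where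
  "g \<in> gens_of \<Sigma> s \<Longrightarrow> list_all2 (tree_of_sort \<Sigma>) (arg_sorts \<Sigma> g) ts
    \<Longrightarrow> tree_of_sort \<Sigma> s (Node g ts)"

text \<open>Nodes are identified with their addresses, i.e. the sequence of child indices leading to them
  from the root; distinct nodes may carry equal labels or equal subtrees.\<close>

inductive is_node :: "'f tree \<Rightarrow> nat list \<Rightarrow> bool" where
  "is_node t []"
| "i < length (children t) \<Longrightarrow> is_node (children t ! i) p \<Longrightarrow> is_node t (i # p)"

definition finite_tree :: "'f tree \<Rightarrow> bool" where
  "finite_tree t \<longleftrightarrow> finite {p. is_node t p}"

definition update_I :: "('s, 'f) signature \<Rightarrow> 's set \<Rightarrow> 's set" where
  "update_I \<Sigma> I = I \<union> {s \<in> sorts \<Sigma>. \<forall>g \<in> gens_of \<Sigma> s. \<forall>i < length (arg_sorts \<Sigma> g).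
     arg_sorts \<Sigma> g ! i \<in> I}"

definition update_F :: "('s, 'f) signature \<Rightarrow> 's set \<Rightarrow> 's set" where
  "update_F \<Sigma> F = F - {s \<in> sorts \<Sigma>. \<exists>g \<in> gens_of \<Sigma> s. \<forall>i < length (arg_sorts \<Sigma> g).
     arg_sorts \<Sigma> g ! i \<notin> F}"

definition iteration :: "('s, 'f) signature \<Rightarrow> 's set \<times> 's set \<Rightarrow> 's set \<times> 's set" where
  "iteration \<Sigma> = (\<lambda>(I, F). (update_I \<Sigma> I, update_F \<Sigma> F))"

text \<open>The result is \<open>Some (S\<^sub>0\<^sub>I, S\<^sub>0\<^sub>F)\<close> if the loop reaches, after finitely many iterations, a state
  that a further iteration leaves unchanged, and \<open>None\<close> if it runs forever.\<close>

definition procedure :: "('s, 'f) signature \<Rightarrow> ('s set \<times> 's set) option" where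
  "procedure \<Sigma> = while_option (\<lambda>st. iteration \<Sigma> st \<noteq> st) (iteration \<Sigma>) ({}, sorts \<Sigma>)"

end

theory Submission
  imports Defs
begin

text \<open>Each iteration keeps \<open>S\<^sub>0\<^sub>I\<close> inside the set of sorts without infinite trees and \<open>S\<^sub>0\<^sub>F\<close> around the
  set of sorts without finite trees. Conversely, at a fixpoint, induction on a finite tree shows
  that no sort of \<open>S\<^sub>0\<^sub>F\<close> has one, and choosing for every sort outside \<open>S\<^sub>0\<^sub>I\<close> a generator with an
  argument sort outside \<open>S\<^sub>0\<^sub>I\<close> unfolds corecursively into a tree with an infinite branch.\<close>

lemma is_node_Node:
  "{p. is_node (Node g ts) p} = insert [] (\<Union>i<length ts. (#) i ` {p. is_node (ts ! i) p})"
  by (auto simp: is_node.simps[of "Node g ts"])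

text \<open>The addresses in a tree are \<open>[]\<close> and, for each of the finitely many
  children, an injective copy of that child's addresses.\<close>

lemma finite_tree_Node: "finite_tree (Node g ts) \<longleftrightarrow> (\<forall>t\<in>set ts. finite_tree t)"
  unfolding finite_tree_def is_node_Node
  by (auto simp: finite_image_iff all_set_conv_all_nth)

text \<open>A codatatype has no structural induction, so the node count serves as the measure.
  Prefixing the child index embeds the addresses of a child injectively into those of the parent,
  and the root address \<open>[]\<close> is missed, so the count drops strictly.\<close>

lemma finite_tree_induct [consumes 1, case_names Node]:
  assumes "finite_tree t"
    and step: "\<And>g ts. (\<And>t. t \<in> set ts \<Longrightarrow> P t) \<Longrightarrow> P (Node g ts)"
  shows "P t"
  using assms(1)
proof (induction "card {p. is_node t p}" arbitrary: t rule: less_induct)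
  case less
  obtain g ts where t: "t = Node g ts" by (cases t)
  have "P u" if "u \<in> set ts" for u
  proof -
    from that obtain i where i: "i < length ts" "u = ts ! i" by (auto simp: in_set_conv_nth)
    have "card {p. is_node u p} = card ((#) i ` {p. is_node u p})"
      by (simp add: card_image)
    also have "\<dots> < card {p. is_node t p}"
    proof (rule psubset_card_mono)
      show "finite {p. is_node t p}" using less.prems by (simp add: finite_tree_def)
      show "(#) i ` {p. is_node u p} \<subset> {p. is_node t p}" unfolding t is_node_Node using i by auto
    qed
    finally show "P u" using less that by (auto simp: t finite_tree_Node)
  qed
  then show ?case unfolding t by (rule step)
qed

text \<open>The corecursion state is a sort: \<open>c\<close> selects a generator for it, and
  \<open>a\<close> gives the sorts from which the children are unfolded.\<close>

primcorec unfold_tree :: "('s \<Rightarrow> 'f) \<Rightarrow> ('f \<Rightarrow> 's list) \<Rightarrow> 's \<Rightarrow> 'f tree" where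
  "unfold_tree c a s = Node (c s) (map (unfold_tree c a) (a (c s)))"

lemma tree_of_sort_unfold_tree:
  assumes wf: "wf_signature \<Sigma>" and c: "\<And>s. s \<in> sorts \<Sigma> \<Longrightarrow> c s \<in> gens_of \<Sigma> s"
    and "s \<in> sorts \<Sigma>"
  shows "tree_of_sort \<Sigma> s (unfold_tree c (arg_sorts \<Sigma>) s)"
proof -
  let ?u = "unfold_tree c (arg_sorts \<Sigma>)"
  have "s \<in> sorts \<Sigma> \<and> t = ?u s \<Longrightarrow> tree_of_sort \<Sigma> s t" for t
  proof (coinduction arbitrary: s t rule: tree_of_sort.coinduct)
    case tree_of_sort
    then have s: "s \<in> sorts \<Sigma>" and t: "t = ?u s" by auto
    have "set (arg_sorts \<Sigma> (c s)) \<subseteq> sorts \<Sigma>"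
      using wf c[OF s] by (auto simp: wf_signature_def gens_of_def)
    moreover have "t = Node (c s) (map ?u (arg_sorts \<Sigma> (c s)))"
      unfolding t by (rule unfold_tree.code)
    ultimately show ?case using c[OF s]
      by (fastforce simp: list_all2_conv_all_nth)
  qed
  then show ?thesis using assms(3) by blast
qed

text \<open>The branch that stays in \<open>A\<close> forever is never built. Instead, induction on
  finite trees shows that none of them is unfolded from a sort in \<open>A\<close>, since it would
  have a child unfolded from a sort in \<open>A\<close> as well.\<close>

lemma infinite_unfold_tree:
  assumes "\<And>s. s \<in> A \<Longrightarrow> \<exists>s'\<in>set (a (c s)). s' \<in> A"
    and "s \<in> A"
  shows "\<not> finite_tree (unfold_tree c a s)"
proof
  assume "finite_tree (unfold_tree c a s)"
  moreover have "s \<in> A \<Longrightarrow> t \<noteq> unfold_tree c a s" if "finite_tree t" for t s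
    using that
  proof (induction arbitrary: s rule: finite_tree_induct)
    case (Node g ts)
    then show ?case
      using assms(1)[of s] by (subst unfold_tree.code) fastforce
  qed
  ultimately show False using assms(2) by blast
qed

lemma update_I_sound:
  assumes "\<And>s t. s \<in> I \<Longrightarrow> tree_of_sort \<Sigma> s t \<Longrightarrow> finite_tree t"
    and "s \<in> update_I \<Sigma> I" and t: "tree_of_sort \<Sigma> s t"
  shows "finite_tree t"
proof (cases "s \<in> I")
  case False
  from t obtain g ts where "t = Node g ts" "g \<in> gens_of \<Sigma> s"
    "list_all2 (tree_of_sort \<Sigma>) (arg_sorts \<Sigma> g) ts" by cases
  moreover from this False assms(2) have "set (arg_sorts \<Sigma> g) \<subseteq> I"
    by (auto simp: update_I_def in_set_conv_nth)
  ultimately show ?thesis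
    using assms(1) by (metis finite_tree_Node in_set_conv_nth list_all2_conv_all_nth subsetD)
qed (use assms in blast)

text \<open>A sort that is removed has a generator whose argument sorts all have finite trees
  already; placing such trees below that generator gives a finite tree.\<close>

lemma update_F_sound:
  assumes F: "\<And>s. s \<in> sorts \<Sigma> - F \<Longrightarrow> \<exists>t. tree_of_sort \<Sigma> s t \<and> finite_tree t"
    and wf: "wf_signature \<Sigma>" and s: "s \<in> sorts \<Sigma> - update_F \<Sigma> F"
  shows "\<exists>t. tree_of_sort \<Sigma> s t \<and> finite_tree t"
proof (cases "s \<in> F")
  case True
  with s obtain g where g: "g \<in> gens_of \<Sigma> s" and
    gF: "\<forall>i < length (arg_sorts \<Sigma> g). arg_sorts \<Sigma> g ! i \<notin> F" by (auto simp: update_F_def)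
  have "set (arg_sorts \<Sigma> g) \<subseteq> sorts \<Sigma> - F"
    using g gF wf by (auto simp: wf_signature_def gens_of_def in_set_conv_nth)
  with F obtain h where
    h: "\<And>s. s \<in> set (arg_sorts \<Sigma> g) \<Longrightarrow> tree_of_sort \<Sigma> s (h s) \<and> finite_tree (h s)"
    by (metis subsetD)
  have "tree_of_sort \<Sigma> s (Node g (map h (arg_sorts \<Sigma> g)))"
    using g h by (intro tree_of_sort.intros) (auto simp: list_all2_conv_all_nth)
  moreover have "finite_tree (Node g (map h (arg_sorts \<Sigma> g)))"
    using h by (auto simp: finite_tree_Node)
  ultimately show ?thesis by blast
qed (use F s in blast)

lemma update_I_fixpoint:
  assumes fp: "update_I \<Sigma> I = I" and wf: "wf_signature \<Sigma>" and s: "s \<in> sorts \<Sigma> - I"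
  shows "\<exists>t. tree_of_sort \<Sigma> s t \<and> \<not> finite_tree t"
proof -
  \<comment> \<open>The choice must cover sorts in \<open>I\<close> too, because siblings of the
    infinite branch may have such sorts. There any generator will do, and one exists by
    well-formedness.\<close>
  have "\<exists>g\<in>gens_of \<Sigma> s. s \<notin> I \<longrightarrow> (\<exists>s'\<in>set (arg_sorts \<Sigma> g). s' \<in> sorts \<Sigma> - I)"
    if sort: "s \<in> sorts \<Sigma>" for s
  proof (cases "s \<in> I")
    case True
    then show ?thesis using wf sort by (auto simp: wf_signature_def)
  next
    case False
    then have "s \<notin> update_I \<Sigma> I" using fp by simp
    then obtain g i where "g \<in> gens_of \<Sigma> s" "i < length (arg_sorts \<Sigma> g)" "arg_sorts \<Sigma> g ! i \<notin> I"
      using sort by (auto simp: update_I_def)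
    moreover from this have "arg_sorts \<Sigma> g ! i \<in> sorts \<Sigma>"
      using wf nth_mem by (fastforce simp: wf_signature_def gens_of_def)
    ultimately show ?thesis using nth_mem by blast
  qed
  then obtain c where c: "\<And>s. s \<in> sorts \<Sigma> \<Longrightarrow> c s \<in> gens_of \<Sigma> s \<and>
      (s \<notin> I \<longrightarrow> (\<exists>s'\<in>set (arg_sorts \<Sigma> (c s)). s' \<in> sorts \<Sigma> - I))"
    by metis
  have "tree_of_sort \<Sigma> s (unfold_tree c (arg_sorts \<Sigma>) s)"
    using tree_of_sort_unfold_tree[OF wf] c s by blast
  moreover have "\<not> finite_tree (unfold_tree c (arg_sorts \<Sigma>) s)"
    using c s by (intro infinite_unfold_tree[where A = "sorts \<Sigma> - I"]) blast+
  ultimately show ?thesis by blast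
qed

text \<open>By induction the argument sorts at the root of a finite tree lie outside
  \<open>F\<close>, so if \<open>s\<close> were in \<open>F\<close>, one more update would remove
  it.\<close>

lemma update_F_fixpoint:
  assumes fp: "update_F \<Sigma> F = F" and sub: "F \<subseteq> sorts \<Sigma>"
    and "finite_tree t" "tree_of_sort \<Sigma> s t"
  shows "s \<notin> F"
  using assms(3,4)
proof (induction arbitrary: s rule: finite_tree_induct)
  case (Node g ts)
  from Node.prems have g: "g \<in> gens_of \<Sigma> s"
    and ts: "list_all2 (tree_of_sort \<Sigma>) (arg_sorts \<Sigma> g) ts"
    by (auto elim: tree_of_sort.cases)
  have "\<forall>i < length (arg_sorts \<Sigma> g). arg_sorts \<Sigma> g ! i \<notin> F"
    using ts Node.IH by (metis list_all2_conv_all_nth nth_mem)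
  \<comment> \<open>An update removes only members of \<open>sorts \<Sigma>\<close>, hence the
    appeal to \<open>sub\<close>.\<close>
  with g sub have "s \<notin> update_F \<Sigma> F" by (auto simp: update_F_def)
  with fp show ?case by simp
qed

text \<open>\<open>I\<close> only grows and \<open>F\<close> only shrinks, both within the finite
  set of sorts. While the state still changes, one of the two does so strictly, and the measure
  decreases.\<close>

lemma procedure_terminates:
  assumes "finite (sorts \<Sigma>)"
  shows "\<exists>st. procedure \<Sigma> = Some st"
  unfolding procedure_def
proof (rule measure_while_option_Some[where P = "\<lambda>(I, F). I \<subseteq> sorts \<Sigma> \<and> F \<subseteq> sorts \<Sigma>"
      and f = "\<lambda>(I, F). card (sorts \<Sigma> - I) + card F"], goal_cases)
  case (1 st)
  obtain I F where st: "st = (I, F)" by (cases st)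
  have I: "I \<subseteq> update_I \<Sigma> I" "update_I \<Sigma> I \<subseteq> sorts \<Sigma>"
    and F: "update_F \<Sigma> F \<subseteq> F" and "F \<subseteq> sorts \<Sigma>"
    using 1 by (auto simp: st update_I_def update_F_def)
  then have fin: "finite F" using assms finite_subset by blast
  have le: "card (sorts \<Sigma> - update_I \<Sigma> I) \<le> card (sorts \<Sigma> - I)" "card (update_F \<Sigma> F) \<le> card F"
    using I F assms fin by (auto intro!: card_mono)
  consider "I \<subset> update_I \<Sigma> I" | "update_F \<Sigma> F \<subset> F"
    using 1 I F by (auto simp: st iteration_def)
  then have "card (sorts \<Sigma> - update_I \<Sigma> I) + card (update_F \<Sigma> F) < card (sorts \<Sigma> - I) + card F"
  proof cases
    case 1
    then have "sorts \<Sigma> - update_I \<Sigma> I \<subset> sorts \<Sigma> - I" using I by blast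
    then have "card (sorts \<Sigma> - update_I \<Sigma> I) < card (sorts \<Sigma> - I)"
      using assms by (intro psubset_card_mono) auto
    then show ?thesis using le by linarith
  next
    case 2
    then have "card (update_F \<Sigma> F) < card F" using fin by (intro psubset_card_mono)
    then show ?thesis using le by linarith
  qed
  then show ?case using I F \<open>F \<subseteq> sorts \<Sigma>\<close> by (auto simp: st iteration_def)
qed auto

lemma procedure_correct:
  assumes wf: "wf_signature \<Sigma>" and res: "procedure \<Sigma> = Some (I, F)"
  shows "F = {s \<in> sorts \<Sigma>. \<not> (\<exists>t. tree_of_sort \<Sigma> s t \<and> finite_tree t)}"
    and "I = {s \<in> sorts \<Sigma>. \<not> (\<exists>t. tree_of_sort \<Sigma> s t \<and> \<not> finite_tree t)}"
proof -
  \<comment> \<open>The invariant holds one inclusion for each component; the opposite inclusions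
    come from the fixpoint equations available once the loop has stopped.\<close>
  let ?inv = "\<lambda>(I, F). I \<subseteq> sorts \<Sigma> \<and> F \<subseteq> sorts \<Sigma> \<and>
    (\<forall>s t. s \<in> I \<longrightarrow> tree_of_sort \<Sigma> s t \<longrightarrow> finite_tree t) \<and>
    (\<forall>s \<in> sorts \<Sigma> - F. \<exists>t. tree_of_sort \<Sigma> s t \<and> finite_tree t)"
  have step: "?inv (iteration \<Sigma> st)" if "?inv st" for st
  proof -
    obtain I F where st: "st = (I, F)" by (cases st)
    have "update_I \<Sigma> I \<subseteq> sorts \<Sigma>" "update_F \<Sigma> F \<subseteq> sorts \<Sigma>"
      using that by (auto simp: st update_I_def update_F_def)
    moreover have "finite_tree t" if "s \<in> update_I \<Sigma> I" "tree_of_sort \<Sigma> s t" for s t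
      using update_I_sound[OF _ that] \<open>?inv st\<close> by (simp add: st)
    moreover have "\<exists>t. tree_of_sort \<Sigma> s t \<and> finite_tree t" if "s \<in> sorts \<Sigma> - update_F \<Sigma> F" for s
      using update_F_sound[OF _ wf that] \<open>?inv st\<close> by (simp add: st)
    ultimately show ?thesis by (simp add: st iteration_def)
  qed
  have "?inv (I, F)"
    by (rule while_option_rule[where P = ?inv, OF step res[unfolded procedure_def]]) auto
  moreover have "iteration \<Sigma> (I, F) = (I, F)"
    using while_option_stop[OF res[unfolded procedure_def]] by simp
  then have "update_I \<Sigma> I = I" "update_F \<Sigma> F = F" by (auto simp: iteration_def)
  ultimately show "F = {s \<in> sorts \<Sigma>. \<not> (\<exists>t. tree_of_sort \<Sigma> s t \<and> finite_tree t)}"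
    and "I = {s \<in> sorts \<Sigma>. \<not> (\<exists>t. tree_of_sort \<Sigma> s t \<and> \<not> finite_tree t)}"
    using update_F_fixpoint[of \<Sigma> F] update_I_fixpoint[OF _ wf, of I] by blast+
qed

text \<open>Termination is claimed for finitely many sorts only: on an infinite chain of sorts, each
  built solely from the previous one, the loop runs forever. The description of the result holds
  whenever the loop stops.\<close>

theorem theorem5:
  fixes \<Sigma> :: "('s, 'f) signature"
  assumes "wf_signature \<Sigma>"
  shows "(finite (sorts \<Sigma>) \<longrightarrow> (\<exists>S0I S0F. procedure \<Sigma> = Some (S0I, S0F))) \<and>
    (\<forall>S0I S0F. procedure \<Sigma> = Some (S0I, S0F) \<longrightarrow>
       S0F = {s \<in> sorts \<Sigma>. \<not> (\<exists>t. tree_of_sort \<Sigma> s t \<and> finite_tree t)} \<and>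
       S0I = {s \<in> sorts \<Sigma>. \<not> (\<exists>t. tree_of_sort \<Sigma> s t \<and> \<not> finite_tree t)})"
  using procedure_terminates[of \<Sigma>] procedure_correct[OF assms] by auto

end
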